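(* Let $p$ be an odd prime and $n$ an integer greater than $1$. A link $L$ with $p$-nullity $n$ has exactly \[ \frac{p^{n-1}-1}{p-1} \] equivalence classes of $p$-colorings.
   Context: Given a diagram $D$ of a link and an integer $m>1$, an $m$-coloring (Fox coloring) of $D$ is an assignment $\mathcal{C}$ of elements of $\mathbf{Z}_m=\mathbf{Z}/m\mathbf{Z}$ (colors) to the arcs of $D$ such that at each crossing, with over-arc $b$ and under-arcs $a,c$, one has $2\mathcal{C}(b)=\mathcal{C}(a)+\mathcal{C}(c)$ in $\mathbf{Z}_m$. An $m$-coloring is trivial if it assigns the same color to every arc, and non-trivial otherwise. $m\mathcal{C}D$ denotes the set of non-trivial $m$-colorings of $D$. The coloring matrix of $D$ is the integer coefficient matrix of the homogeneous linear system with one variable per arc and one equation (under-arc $+$ under-arc $-\,2\cdot$ over-arc $=0$) per crossing; it is regarded as a square matrix with one column per arc (append zero rows if there are fewer crossings than arcs). For a prime $p$, the $p$-nullity of $L$ is the number of diagonal entries that are $0$ modulo $p$ in the Smith Normal Form over $\mathbf{Z}$ of the coloring matrix of a diagram of $L$; it does not depend on the diagram. $\mathbf{Aut}_p$ is the group of permutations of $\mathbf{Z}_p$ of the form $f_{\lambda,\mu}(x)=\lambda x+\mu$ with $\lambda\in\mathbf{Z}_p^{\ast}$ and $\mu\in\mathbf{Z}_p$. It acts on $p\mathcal{C}D$ by $(g\mathcal{C})(a)=g(\mathcal{C}(a))$ for each arc $a$. The equivalence classes of $p$-colorings of $L$ are the orbits of $\mathbf{Aut}_p$ on $p\mathcal{C}D$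 for a diagram $D$ of $L$ (only non-trivial colorings are considered); their number does not depend on the diagram. *)

theory Defs
  imports
    "HOL-Analysis.Analysis"
    "HOL-Number_Theory.Residues"
    "HOL-Algebra.Group_Action"
    "Jordan_Normal_Form.Matrix"
begin

section \<open>Links and their diagrams\<close>

text \<open>
  A link with k components is given by k closed regular curves of class C1 in 3-space, each
  written as a function of period 1, that are jointly injective on one period. Links are
  considered up to ambient isotopy, which includes every tame link.
\<close>

definition link_embedding :: "nat \<Rightarrow> (nat \<Rightarrow> real \<Rightarrow> real ^ 3) \<Rightarrow> bool" where
  "link_embedding k \<gamma> \<longleftrightarrow>
     0 < k \<and>
     (\<forall>i<k. \<gamma> i C1_differentiable_on UNIV \<and>
            (\<forall>t. \<gamma> i (t + 1) = \<gamma> i t) \<and>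
            (\<forall>t. vector_derivative (\<gamma> i) (at t) \<noteq> 0)) \<and>
     inj_on (\<lambda>(i, t). \<gamma> i t) ({..<k} \<times> {0..<1})"

definition ambient_isotopic :: "(real ^ 3) set \<Rightarrow> (real ^ 3) set \<Rightarrow> bool" where
  "ambient_isotopic L L' \<longleftrightarrow>
     (\<exists>H :: real \<Rightarrow> real ^ 3 \<Rightarrow> real ^ 3.
        continuous_on ({0..1} \<times> UNIV) (\<lambda>(s, x). H s x) \<and>
        (\<forall>s\<in>{0..1}. \<exists>h. homeomorphism UNIV UNIV (H s) h) \<and>
        (\<forall>x. H 0 x = x) \<and>
        H 1 ` L = L')"

definition is_link :: "(real ^ 3) set \<Rightarrow> bool" where
  "is_link L \<longleftrightarrow>
     (\<exists>k \<gamma>. link_embedding k \<gamma> \<and> ambient_isotopic L (\<Union>i<k. range (\<gamma> i)))"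

text \<open>
  A diagram is a link in general position with respect to the vertical projection to the plane;
  the third coordinate records which strand passes over which.
\<close>

record link_diagram =
  num_comps :: nat
  strand :: "nat \<Rightarrow> real \<Rightarrow> real ^ 3"

definition proj :: "real ^ 3 \<Rightarrow> real ^ 2" where
  "proj x = vector [vec_nth x 1, vec_nth x 2]"

definition height :: "real ^ 3 \<Rightarrow> real" where
  "height x = vec_nth x 3"

definition params :: "link_diagram \<Rightarrow> (nat \<times> real) set" where
  "params D = {..<num_comps D} \<times> {0..<1}"

definition pt :: "link_diagram \<Rightarrow> nat \<times> real \<Rightarrow> real ^ 3" where
  "pt D x = strand D (fst x) (snd x)"

definition velocity :: "link_diagram \<Rightarrow> nat \<times> real \<Rightarrow> real ^ 3" where
  "velocity D x = vector_derivative (strand D (fst x)) (at (snd x))"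

text \<open>
  A crossing is the pair (u, v) of the parameters of its under-point u and its over-point v.
\<close>

definition crossings :: "link_diagram \<Rightarrow> ((nat \<times> real) \<times> (nat \<times> real)) set" where
  "crossings D =
     {(u, v). u \<in> params D \<and> v \<in> params D \<and>
              proj (pt D u) = proj (pt D v) \<and> height (pt D u) < height (pt D v)}"

text \<open>
  General position: the projection restricts to an immersion of the curves whose multiple points
  are finitely many transverse double points.
\<close>

definition is_diagram :: "link_diagram \<Rightarrow> bool" where
  "is_diagram D \<longleftrightarrow>
     link_embedding (num_comps D) (strand D) \<and>
     (\<forall>x\<in>params D. proj (velocity D x) \<noteq> 0) \<and>
     finite (crossings D) \<and>
     (\<forall>x\<in>params D. \<forall>y\<in>params D. \<forall>z\<in>params D.
        proj (pt D x) = proj (pt D y) \<and> proj (pt D y) = proj (pt D z) \<longrightarrow>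
        x = y \<or> y = z \<or> x = z) \<and>
     (\<forall>(u, v)\<in>crossings D. \<not> collinear {0, proj (velocity D u), proj (velocity D v)})"

definition underlying_link :: "link_diagram \<Rightarrow> (real ^ 3) set" where
  "underlying_link D = (\<Union>i<num_comps D. range (strand D i))"

definition diagram_of :: "link_diagram \<Rightarrow> (real ^ 3) set \<Rightarrow> bool" where
  "diagram_of D L \<longleftrightarrow> is_diagram D \<and> ambient_isotopic L (underlying_link D)"

text \<open>
  The arcs are the pieces into which the under-points cut the link. A component without
  under-points is a single (closed) arc.
\<close>

definition cut_link :: "link_diagram \<Rightarrow> (real ^ 3) set" where
  "cut_link D = underlying_link D - {pt D u | u v. (u, v) \<in> crossings D}"

definition arcs :: "link_diagram \<Rightarrow> (real ^ 3) set set" where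
  "arcs D = components (cut_link D)"

definition over_arc :: "link_diagram \<Rightarrow> (nat \<times> real) \<times> (nat \<times> real) \<Rightarrow> (real ^ 3) set" where
  "over_arc D c = connected_component_set (cut_link D) (pt D (snd c))"

text \<open>
  The two under-arcs of a crossing are the arcs that end and start at its under-point, with
  respect to the direction of the parametrization; they may coincide.
\<close>

definition under_arc_in :: "link_diagram \<Rightarrow> (nat \<times> real) \<times> (nat \<times> real) \<Rightarrow> (real ^ 3) set" where
  "under_arc_in D c =
     (THE a. a \<in> arcs D \<and>
             eventually (\<lambda>s. strand D (fst (fst c)) s \<in> a) (at_left (snd (fst c))))"

definition under_arc_out :: "link_diagram \<Rightarrow> (nat \<times> real) \<times> (nat \<times> real) \<Rightarrow> (real ^ 3) set" where
  "under_arc_out D c =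
     (THE a. a \<in> arcs D \<and>
             eventually (\<lambda>s. strand D (fst (fst c)) s \<in> a) (at_right (snd (fst c))))"


section \<open>Fox colorings\<close>

definition colorings :: "link_diagram \<Rightarrow> nat \<Rightarrow> ((real ^ 3) set \<Rightarrow> int) set" where
  "colorings D m =
     {C \<in> arcs D \<rightarrow>\<^sub>E carrier (residue_ring (int m)).
        \<forall>c\<in>crossings D.
          C (over_arc D c) \<oplus>\<^bsub>residue_ring (int m)\<^esub> C (over_arc D c) =
          C (under_arc_in D c) \<oplus>\<^bsub>residue_ring (int m)\<^esub> C (under_arc_out D c)}"

definition trivial_coloring :: "link_diagram \<Rightarrow> ((real ^ 3) set \<Rightarrow> int) \<Rightarrow> bool" where
  "trivial_coloring D C \<longleftrightarrow> (\<forall>a\<in>arcs D. \<forall>b\<in>arcs D. C a = C b)"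

definition nontrivial_colorings :: "link_diagram \<Rightarrow> nat \<Rightarrow> ((real ^ 3) set \<Rightarrow> int) set" where
  "nontrivial_colorings D m = {C \<in> colorings D m. \<not> trivial_coloring D C}"


section \<open>The coloring matrix and the p-nullity\<close>

text \<open>The summands add up when some of the three arcs at a crossing coincide.\<close>

definition coloring_coeff ::
    "link_diagram \<Rightarrow> (nat \<times> real) \<times> (nat \<times> real) \<Rightarrow> (real ^ 3) set \<Rightarrow> int" where
  "coloring_coeff D c a =
     of_bool (a = under_arc_in D c) + of_bool (a = under_arc_out D c)
       - 2 * of_bool (a = over_arc D c)"

text \<open>
  The coloring matrix depends on how arcs and crossings are enumerated. A diagram never has more
  crossings than arcs (each crossing starts its own outgoing under-arc), so the number of rows
  below is the number of arcs and the matrix is square; the maximum only makes it evident that no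
  equation is dropped.
\<close>

definition is_coloring_matrix :: "link_diagram \<Rightarrow> int mat \<Rightarrow> bool" where
  "is_coloring_matrix D A \<longleftrightarrow>
     (\<exists>as cs. distinct as \<and> set as = arcs D \<and> distinct cs \<and> set cs = crossings D \<and>
        A = mat (max (length as) (length cs)) (length as)
              (\<lambda>(i, j). if i < length cs then coloring_coeff D (cs ! i) (as ! j) else 0))"

definition is_smith_normal_form :: "int mat \<Rightarrow> int mat \<Rightarrow> bool" where
  "is_smith_normal_form A S \<longleftrightarrow>
     (\<exists>P Q. P \<in> carrier_mat (dim_row A) (dim_row A) \<and> invertible_mat P \<and>
            Q \<in> carrier_mat (dim_col A) (dim_col A) \<and> invertible_mat Q \<and>
            S = P * A * Q) \<and>
     (\<forall>i<dim_row S. \<forall>j<dim_col S. i \<noteq> j \<longrightarrow> S $$ (i, j) = 0) \<and>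
     (\<forall>i<min (dim_row S) (dim_col S). 0 \<le> S $$ (i, i)) \<and>
     (\<forall>i. Suc i < min (dim_row S) (dim_col S) \<longrightarrow> S $$ (i, i) dvd S $$ (Suc i, Suc i))"

definition has_nullity :: "link_diagram \<Rightarrow> nat \<Rightarrow> nat \<Rightarrow> bool" where
  "has_nullity D p n \<longleftrightarrow>
     (\<exists>A S. is_coloring_matrix D A \<and> is_smith_normal_form A S \<and>
        n = card {i. i < min (dim_row S) (dim_col S) \<and> [S $$ (i, i) = 0] (mod int p)})"


section \<open>Equivalence of colorings\<close>

definition Aut_mod :: "nat \<Rightarrow> (int \<Rightarrow> int) monoid" where
  "Aut_mod p =
     (let R = residue_ring (int p) in
      BijGroup (carrier R)
        \<lparr>carrier := {\<lambda>x\<in>carrier R. l \<otimes>\<^bsub>R\<^esub> x \<oplus>\<^bsub>R\<^esub> m | l m. l \<in> Units R \<and> m \<in> carrier R}\<rparr>)"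

definition coloring_classes :: "link_diagram \<Rightarrow> nat \<Rightarrow> ((real ^ 3) set \<Rightarrow> int) set set" where
  "coloring_classes D p =
     orbits (Aut_mod p) (nontrivial_colorings D p) (\<lambda>g C. compose (arcs D) g C)"

end

theory Submission
  imports Defs
begin

text \<open>
  Since the transformation matrices of the Smith normal form stay invertible modulo p, the
  p-colorings form a space of dimension n, hence there are p^n of them, p of which are trivial.
  A non-trivial coloring takes two different values, so only the identity of the affine group
  fixes it; thus every orbit has p(p - 1) elements. To read the colorings as the kernel of the
  coloring matrix one needs that the arcs at a crossing exist: near an under-point the strand
  meets no other under-point, so on either side it stays in one component of the cut link.
\<close>

unbundle no vec_syntax

section \<open>Arcs at a crossing\<close>

lemma link_embedding_periodic:
  assumes "link_embedding k \<gamma>" "i < k"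
  shows "\<gamma> i (frac t) = \<gamma> i t"
proof -
  have per: "\<gamma> i (t + 1) = \<gamma> i t" for t
    using assms by (auto simp: link_embedding_def)
  have nat: "\<gamma> i (t + real m) = \<gamma> i t" for t m
  proof (induction m)
    case (Suc m)
    have "\<gamma> i (t + real (Suc m)) = \<gamma> i ((t + real m) + 1)" by (simp add: algebra_simps)
    then show ?case using per Suc by simp
  qed simp
  have "\<gamma> i (t + of_int z) = \<gamma> i t" for z
  proof (cases "z \<ge> 0")
    case True
    then show ?thesis using nat[of t "nat z"] by simp
  next
    case False
    then show ?thesis using nat[of "t + of_int z" "nat (- z)"] by simp
  qed
  from this[of "- \<lfloor>t\<rfloor>"] show ?thesis by (simp add: frac_def)
qed

text \<open>Injectivity is only assumed on \<open>{0..<1}\<close>, so both parameters are first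
  replaced by their fractional parts. This locates every time at which a strand can pass through a
  given point: such times differ by integers.\<close>

lemma link_embedding_eq_imp_frac_eq:
  assumes "link_embedding k \<gamma>" "i < k" "j < k" "\<gamma> i s = \<gamma> j t"
  shows "frac s = frac t"
proof -
  have inj: "inj_on (\<lambda>(i, t). \<gamma> i t) ({..<k} \<times> {0..<1})"
    using assms(1) by (simp add: link_embedding_def)
  have "\<gamma> i (frac s) = \<gamma> j (frac t)"
    using assms by (simp add: link_embedding_periodic)
  then have "(i, frac s) = (j, frac t)"
    using inj_onD[OF inj, of "(i, frac s)" "(j, frac t)"] assms(2,3) by (simp add: frac_lt_1)
  then show ?thesis by simp
qed

lemma link_embedding_continuous:
  assumes "link_embedding k \<gamma>" "i < k"
  shows "continuous_on X (\<gamma> i)"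
proof -
  have "\<gamma> i C1_differentiable_on UNIV"
    using assms by (auto simp: link_embedding_def)
  then show ?thesis
    using C1_differentiable_imp_continuous_on continuous_on_subset by blast
qed

text \<open>The over-point must survive the cutting. If \<open>pt D v\<close> were also the
  under-point of a crossing \<open>(u', v')\<close>, then \<open>u\<close>, \<open>v\<close> and
  \<open>v'\<close> would project to one point, so two of them would agree, and each of the three
  equalities contradicts the strict inequalities between heights.\<close>

lemma over_arc_in_arcs:
  assumes D: "is_diagram D" and c: "c \<in> crossings D"
  shows "over_arc D c \<in> arcs D"
proof -
  obtain u v where uv: "c = (u, v)" by (cases c)
  have v: "v \<in> params D" and u: "u \<in> params D"
    and pr: "proj (pt D u) = proj (pt D v)" and ht: "height (pt D u) < height (pt D v)"
    using c by (auto simp: uv crossings_def)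
  have "pt D v \<noteq> pt D u'" if "(u', v') \<in> crossings D" for u' v'
  proof
    assume eq: "pt D v = pt D u'"
    have *: "u' \<in> params D" "v' \<in> params D" "proj (pt D u') = proj (pt D v')"
      "height (pt D u') < height (pt D v')"
      using that by (auto simp: crossings_def)
    have "u = v \<or> v = v' \<or> u = v'"
      using D u v * pr eq unfolding is_diagram_def by metis
    then show False using ht * eq by auto
  qed
  moreover have "pt D v \<in> underlying_link D"
    unfolding pt_def underlying_link_def
    using v by (intro UN_I[of "fst v"] rangeI) (auto simp: params_def)
  ultimately have "pt D v \<in> cut_link D" by (auto simp: cut_link_def)
  then show ?thesis by (auto simp: over_arc_def arcs_def uv components_def)
qed

text \<open>There are finitely many crossings, so a strand meets under-points only at isolated
  times. The time \<open>t\<close> itself is excluded because it may be one of them.\<close>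

lemma strand_avoids_under_points:
  assumes D: "is_diagram D" and i: "i < num_comps D"
  obtains d where "d > 0" "\<And>s. s \<noteq> t \<Longrightarrow> dist t s < d \<Longrightarrow> strand D i s \<in> cut_link D"
proof -
  have emb: "link_embedding (num_comps D) (strand D)"
    and fin: "finite (crossings D)"
    using D by (auto simp: is_diagram_def)
  \<comment> \<open>Near \<open>t\<close>, a time at which the strand hits an under-point is an
    under-parameter plus its own integer part. \<open>B\<close> is a finite set containing all such
    times; it ranges over the crossings of all components.\<close>
  define B where
    "B = (\<lambda>(c, z). snd (fst c) + of_int z) ` (crossings D \<times> {\<lfloor>t - 1\<rfloor>..\<lfloor>t + 1\<rfloor>})"
  have "finite B" unfolding B_def using fin by simp
  then obtain d where d: "d > 0" "\<forall>x\<in>B. x \<noteq> t \<longrightarrow> d \<le> dist t x"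
    using finite_set_avoid by blast
  \<comment> \<open>The bound 1 keeps the integer part of \<open>s\<close> within the range used for
    \<open>B\<close>; the bound \<open>d\<close> then keeps \<open>s\<close> out of
    \<open>B\<close>.\<close>
  have "strand D i s \<in> cut_link D" if "s \<noteq> t" "dist t s < min d 1" for s
  proof -
    have "strand D i s \<noteq> pt D u" if c: "(u, v) \<in> crossings D" for u v
    proof
      assume eq: "strand D i s = pt D u"
      have u: "fst u < num_comps D" "0 \<le> snd u" "snd u < 1"
        using c by (auto simp: crossings_def params_def)
      have "frac s = frac (snd u)"
        using link_embedding_eq_imp_frac_eq[OF emb i u(1)] eq by (simp add: pt_def)
      then have "s = snd u + of_int \<lfloor>s\<rfloor>"
        using u frac_eq[of "snd u"] by (simp add: frac_def)
      moreover have "\<lfloor>s\<rfloor> \<in> {\<lfloor>t - 1\<rfloor>..\<lfloor>t + 1\<rfloor>}"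
        using \<open>dist t s < min d 1\<close> unfolding atLeastAtMost_iff dist_real_def
        by (intro conjI floor_mono) linarith+
      ultimately have "s \<in> B"
        unfolding B_def using c by (intro image_eqI[of _ _ "((u, v), \<lfloor>s\<rfloor>)"]) auto
      then show False using d \<open>s \<noteq> t\<close> \<open>dist t s < min d 1\<close> by auto
    qed
    then show ?thesis using i by (auto simp: cut_link_def underlying_link_def)
  qed
  then show thesis using that[of "min d 1"] d(1) by simp
qed

text \<open>A connected piece of the strand lies in a single component, which gives existence. Two
  arcs that both contain the strand eventually along a proper filter must intersect, hence coincide.
  The general filter \<open>F\<close> covers both sides of an under-point at once.\<close>

lemma ex1_arc_of_connected:
  assumes D: "is_diagram D" and i: "i < num_comps D"
    and J: "connected J" "strand D i ` J \<subseteq> cut_link D"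
    and F: "eventually (\<lambda>s. s \<in> J) F" "F \<noteq> bot"
  shows "\<exists>!a. a \<in> arcs D \<and> eventually (\<lambda>s. strand D i s \<in> a) F"
proof -
  have emb: "link_embedding (num_comps D) (strand D)"
    using D by (simp add: is_diagram_def)
  obtain s0 where s0: "s0 \<in> J"
    using eventually_happens'[OF F(2,1)] by blast
  define a where "a = connected_component_set (cut_link D) (strand D i s0)"
  have "connected (strand D i ` J)"
    using J(1) link_embedding_continuous[OF emb i] by (rule connected_continuous_image[rotated])
  then have sub: "strand D i ` J \<subseteq> a"
    unfolding a_def using J(2) s0 by (intro connected_component_maximal) auto
  have "a \<in> arcs D"
    using J(2) s0 by (auto simp: a_def arcs_def components_def)
  moreover have ev: "eventually (\<lambda>s. strand D i s \<in> a) F"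
    using F(1) by eventually_elim (use sub in auto)
  moreover have "b = a" if "b \<in> arcs D" "eventually (\<lambda>s. strand D i s \<in> b) F" for b
  proof -
    have "eventually (\<lambda>s. strand D i s \<in> a \<inter> b) F"
      using ev that(2) by eventually_elim auto
    then have "a \<inter> b \<noteq> {}"
      using eventually_happens'[OF F(2)] by blast
    then show ?thesis
      using components_nonoverlap \<open>a \<in> arcs D\<close> that(1) unfolding arcs_def by blast
  qed
  ultimately show ?thesis by blast
qed

text \<open>This makes the definite description in \<open>under_arc_in\<close> well defined. The
  connected parameter set is an open interval ending at \<open>t\<close>, so the possible
  under-point at \<open>t\<close> is left out.\<close>

lemma ex1_arc_at_left:
  assumes D: "is_diagram D" and i: "i < num_comps D"
  shows "\<exists>!a. a \<in> arcs D \<and> eventually (\<lambda>s. strand D i s \<in> a) (at_left t)"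
proof -
  obtain d where d: "d > 0" "\<And>s. s \<noteq> t \<Longrightarrow> dist t s < d \<Longrightarrow> strand D i s \<in> cut_link D"
    using strand_avoids_under_points[OF assms] by blast
  show ?thesis
  proof (rule ex1_arc_of_connected[OF assms])
    show "strand D i ` {t - d<..<t} \<subseteq> cut_link D"
      using d(2) by (auto simp: dist_real_def)
    show "eventually (\<lambda>s. s \<in> {t - d<..<t}) (at_left t)"
      using d(1) by (intro eventually_at_left_real) simp
  qed auto
qed

lemma ex1_arc_at_right:
  assumes D: "is_diagram D" and i: "i < num_comps D"
  shows "\<exists>!a. a \<in> arcs D \<and> eventually (\<lambda>s. strand D i s \<in> a) (at_right t)"
proof -
  obtain d where d: "d > 0" "\<And>s. s \<noteq> t \<Longrightarrow> dist t s < d \<Longrightarrow> strand D i s \<in> cut_link D"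
    using strand_avoids_under_points[OF assms] by blast
  show ?thesis
  proof (rule ex1_arc_of_connected[OF assms])
    show "strand D i ` {t<..<t + d} \<subseteq> cut_link D"
      using d(2) by (auto simp: dist_real_def)
    show "eventually (\<lambda>s. s \<in> {t<..<t + d}) (at_right t)"
      using d(1) by (intro eventually_at_right_real) simp
  qed auto
qed

lemma under_arcs_in_arcs:
  assumes D: "is_diagram D" and c: "c \<in> crossings D"
  shows "under_arc_in D c \<in> arcs D" "under_arc_out D c \<in> arcs D"
proof -
  have i: "fst (fst c) < num_comps D"
    using c by (auto simp: crossings_def params_def)
  show "under_arc_in D c \<in> arcs D"
    unfolding under_arc_in_def using theI'[OF ex1_arc_at_left[OF D i]] by blast
  show "under_arc_out D c \<in> arcs D"
    unfolding under_arc_out_def using theI'[OF ex1_arc_at_right[OF D i]] by blast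
qed


section \<open>Solutions of a homogeneous system modulo an integer\<close>

abbreviation vec_mod :: "int \<Rightarrow> int vec \<Rightarrow> int vec" where
  "vec_mod q \<equiv> map_vec (\<lambda>a. a mod q)"

text \<open>The condition \<open>vec_mod q x = x\<close> selects one integer representative per
  residue vector, so that the cardinality counts solutions over the residue ring.\<close>

definition kernel_mod :: "int \<Rightarrow> int mat \<Rightarrow> int vec set" where
  "kernel_mod q A =
     {x \<in> carrier_vec (dim_col A). vec_mod q x = x \<and> vec_mod q (A *\<^sub>v x) = 0\<^sub>v (dim_row A)}"

lemma vec_mod_idem: "vec_mod q (vec_mod q x) = vec_mod q x"
  by (rule eq_vecI) auto

lemma vec_mod_mult_mat_vec:
  assumes "dim_vec x = dim_col M"
  shows "vec_mod q (M *\<^sub>v vec_mod q x) = vec_mod q (M *\<^sub>v x)"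
proof (rule eq_vecI)
  fix i assume "i < dim_vec (vec_mod q (M *\<^sub>v x))"
  then have i: "i < dim_row M" by simp
  have "(\<Sum>j<dim_vec x. M $$ (i, j) * (x $ j mod q)) mod q
      = (\<Sum>j<dim_vec x. (M $$ (i, j) * (x $ j mod q)) mod q) mod q"
    by (simp add: mod_sum_eq)
  also have "\<dots> = (\<Sum>j<dim_vec x. (M $$ (i, j) * x $ j) mod q) mod q"
    by (simp add: mod_mult_right_eq)
  also have "\<dots> = (\<Sum>j<dim_vec x. M $$ (i, j) * x $ j) mod q"
    by (simp add: mod_sum_eq)
  finally show "vec_mod q (M *\<^sub>v vec_mod q x) $ i = vec_mod q (M *\<^sub>v x) $ i"
    using i assms by (simp add: scalar_prod_def atLeast0LessThan)
qed simp

lemma invertible_mat_obtain_inverse: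
  assumes "M \<in> carrier_mat n n" "invertible_mat M"
  obtains N where "N \<in> carrier_mat n n" "M * N = 1\<^sub>m n" "N * M = 1\<^sub>m n"
proof -
  obtain N where N: "inverts_mat M N" "inverts_mat N M"
    using assms(2) by (auto simp: invertible_mat_def)
  have 1: "M * N = 1\<^sub>m n" and 2: "N * M = 1\<^sub>m (dim_row N)"
    using N assms(1) by (auto simp: inverts_mat_def)
  \<comment> \<open>\<open>inverts_mat\<close> does not fix the size of \<open>N\<close>; comparing
    the column counts of both products with those of the identity matrices does.\<close>
  from arg_cong[OF 1, of dim_col] arg_cong[OF 2, of dim_col]
  have "N \<in> carrier_mat n n" using assms(1) by auto
  then show thesis using that 1 2 by auto
qed

text \<open>Integral inverses remain inverses modulo \<open>q\<close>: multiplication by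
  \<open>Q\<close> is a change of variables between the two kernels, and \<open>P\<close> only
  replaces the equations by equivalent ones.\<close>

lemma card_kernel_mod_equivalent:
  assumes A: "A \<in> carrier_mat r k"
    and P: "P \<in> carrier_mat r r" "invertible_mat P"
    and Q: "Q \<in> carrier_mat k k" "invertible_mat Q"
  shows "card (kernel_mod q (P * A * Q)) = card (kernel_mod q A)"
proof -
  obtain P' where P': "P' \<in> carrier_mat r r" "P' * P = 1\<^sub>m r"
    using invertible_mat_obtain_inverse[OF P] by blast
  obtain Q' where Q': "Q' \<in> carrier_mat k k" "Q * Q' = 1\<^sub>m k" "Q' * Q = 1\<^sub>m k"
    using invertible_mat_obtain_inverse[OF Q] by blast
  let ?f = "\<lambda>y. vec_mod q (Q *\<^sub>v y)" and ?g = "\<lambda>x. vec_mod q (Q' *\<^sub>v x)"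
  have inv: "vec_mod q (M *\<^sub>v vec_mod q (N *\<^sub>v x)) = x"
    if "M \<in> carrier_mat k k" "N \<in> carrier_mat k k" "M * N = 1\<^sub>m k"
      "x \<in> carrier_vec k" "vec_mod q x = x" for M N x
  proof -
    have "vec_mod q (M *\<^sub>v vec_mod q (N *\<^sub>v x)) = vec_mod q (M *\<^sub>v (N *\<^sub>v x))"
      using that by (intro vec_mod_mult_mat_vec) auto
    also have "M *\<^sub>v (N *\<^sub>v x) = x"
      using that by (simp flip: assoc_mult_mat_vec)
    finally show ?thesis using that by simp
  qed
  have zero: "vec_mod q (M *\<^sub>v v) = 0\<^sub>v r"
    if "M \<in> carrier_mat r r" "v \<in> carrier_vec r" "vec_mod q v = 0\<^sub>v r" for M v
  proof -
    have "vec_mod q (M *\<^sub>v v) = vec_mod q (M *\<^sub>v 0\<^sub>v r)"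
      using vec_mod_mult_mat_vec[of v M q] that by simp
    also have "\<dots> = 0\<^sub>v r"
      using that by (intro eq_vecI) auto
    finally show ?thesis .
  qed
  have S: "P * A * Q \<in> carrier_mat r k" using A P Q by simp
  have PAQ: "P *\<^sub>v (A *\<^sub>v (Q *\<^sub>v y)) = (P * A * Q) *\<^sub>v y" if "y \<in> carrier_vec k" for y
  proof -
    have "(P * A * Q) *\<^sub>v y = (P * A) *\<^sub>v (Q *\<^sub>v y)"
      using that A P Q by (intro assoc_mult_mat_vec) auto
    also have "\<dots> = P *\<^sub>v (A *\<^sub>v (Q *\<^sub>v y))"
      using that A P Q by (intro assoc_mult_mat_vec) auto
    finally show ?thesis by simp
  qed
  have f: "?f y \<in> kernel_mod q A" if y: "y \<in> kernel_mod q (P * A * Q)" for y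
  proof -
    have yc: "y \<in> carrier_vec k" and y0: "vec_mod q ((P * A * Q) *\<^sub>v y) = 0\<^sub>v r"
      using y A P Q by (auto simp: kernel_mod_def)
    \<comment> \<open>The inverse of \<open>P\<close> strips the left factor, so vanishing modulo
      \<open>q\<close> passes from \<open>P * A * Q\<close> applied to \<open>y\<close> to
      \<open>A\<close> applied to \<open>Q *\<^sub>v y\<close>.\<close>
    have "P' *\<^sub>v ((P * A * Q) *\<^sub>v y) = (P' * P) *\<^sub>v (A *\<^sub>v (Q *\<^sub>v y))"
      unfolding PAQ[OF yc, symmetric]
      using yc A P Q P' by (intro assoc_mult_mat_vec[symmetric]) auto
    also have "\<dots> = A *\<^sub>v (Q *\<^sub>v y)"
      using yc A Q P' by simp
    finally have "vec_mod q (A *\<^sub>v (Q *\<^sub>v y)) = 0\<^sub>v r"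
      using zero[OF P'(1) _ y0] S yc by simp
    moreover have "vec_mod q (A *\<^sub>v vec_mod q (Q *\<^sub>v y)) = vec_mod q (A *\<^sub>v (Q *\<^sub>v y))"
      using yc A Q by (intro vec_mod_mult_mat_vec) auto
    ultimately show ?thesis
      using yc A Q by (auto simp: kernel_mod_def vec_mod_idem)
  qed
  have g: "?g x \<in> kernel_mod q (P * A * Q)" if x: "x \<in> kernel_mod q A" for x
  proof -
    have xc: "x \<in> carrier_vec k" and x0: "vec_mod q (A *\<^sub>v x) = 0\<^sub>v r"
      using x A by (auto simp: kernel_mod_def)
    have "Q *\<^sub>v (Q' *\<^sub>v x) = x"
      using xc Q Q' by (simp flip: assoc_mult_mat_vec)
    then have "(P * A * Q) *\<^sub>v (Q' *\<^sub>v x) = P *\<^sub>v (A *\<^sub>v x)"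
      using PAQ[of "Q' *\<^sub>v x"] xc Q' by simp
    then have "vec_mod q ((P * A * Q) *\<^sub>v (Q' *\<^sub>v x)) = 0\<^sub>v r"
      using zero[OF P(1) _ x0] xc A by simp
    moreover have "vec_mod q ((P * A * Q) *\<^sub>v ?g x) = vec_mod q ((P * A * Q) *\<^sub>v (Q' *\<^sub>v x))"
      using xc S Q' Q by (intro vec_mod_mult_mat_vec) auto
    ultimately show ?thesis
      using xc P Q Q' by (auto simp: kernel_mod_def vec_mod_idem)
  qed
  have "bij_betw ?f (kernel_mod q (P * A * Q)) (kernel_mod q A)"
  proof (rule bij_betw_byWitness[of _ ?g])
    show "\<forall>y\<in>kernel_mod q (P * A * Q). ?g (?f y) = y"
      using inv[OF Q'(1) Q(1) Q'(3)] Q by (auto simp: kernel_mod_def)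
    show "\<forall>x\<in>kernel_mod q A. ?f (?g x) = x"
      using inv[OF Q(1) Q'(1) Q'(2)] A by (auto simp: kernel_mod_def)
  qed (use f g in blast)+
  then show ?thesis by (rule bij_betw_same_card)
qed

text \<open>The system decouples into one equation per coordinate. Modulo a prime, a vanishing
  diagonal entry leaves all \<open>p\<close> residues free and any other entry forces 0. The
  assumption \<open>k \<le> r\<close> gives every coordinate a diagonal entry.\<close>

lemma card_kernel_mod_diagonal:
  assumes S: "S \<in> carrier_mat r k" "k \<le> r"
    and diag: "\<And>i j. i < r \<Longrightarrow> j < k \<Longrightarrow> i \<noteq> j \<Longrightarrow> S $$ (i, j) = 0"
    and p: "prime p"
  shows "card (kernel_mod (int p) S) = p ^ card {i. i < k \<and> [S $$ (i, i) = 0] (mod int p)}"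
proof -
  let ?q = "int p"
  have q: "?q > 0" using p prime_gt_0_nat by simp
  \<comment> \<open>\<open>B i\<close> is the set of reduced values allowed for the
    \<open>i\<close>-th coordinate.\<close>
  define B where "B = (\<lambda>i. if [S $$ (i, i) = 0] (mod ?q) then {0..<?q} else {0})"
  have entry: "(S *\<^sub>v x) $ i = (if i < k then S $$ (i, i) * x $ i else 0)"
    if "x \<in> carrier_vec k" "i < r" for x i
  proof -
    have "(S *\<^sub>v x) $ i = (\<Sum>j<k. S $$ (i, j) * x $ j)"
      using S that by (simp add: scalar_prod_def atLeast0LessThan)
    also have "\<dots> = (\<Sum>j<k. if j = i then S $$ (i, i) * x $ i else 0)"
      using diag that by (intro sum.cong) auto
    finally show ?thesis by simp
  qed
  have mem: "x \<in> kernel_mod ?q S \<longleftrightarrow> (\<forall>i<k. x $ i \<in> B i)" if x: "x \<in> carrier_vec k" for x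
  proof -
    have "vec_mod ?q x = x \<longleftrightarrow> (\<forall>i<k. x $ i \<in> {0..<?q})"
    proof -
      have "a mod ?q = a \<longleftrightarrow> a \<in> {0..<?q}" for a
        using q by (metis atLeastLessThan_iff mod_pos_pos_trivial pos_mod_bound pos_mod_sign)
      then show ?thesis using x by (auto simp: vec_eq_iff)
    qed
    moreover have "vec_mod ?q (S *\<^sub>v x) = 0\<^sub>v r \<longleftrightarrow> (\<forall>i<k. ?q dvd S $$ (i, i) * x $ i)"
      using S x entry[OF x] by (auto simp: vec_eq_iff dvd_eq_mod_eq_0)
    moreover have "a \<in> {0..<?q} \<and> ?q dvd S $$ (i, i) * a \<longleftrightarrow> a \<in> B i" for a i
    proof (cases "?q dvd S $$ (i, i)")
      case True
      then show ?thesis by (auto simp: B_def cong_0_iff)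
    next
      case False
      \<comment> \<open>Primality lets the nonzero diagonal entry be cancelled; the only multiple of
        \<open>p\<close> in the reduced range is then 0.\<close>
      have "?q dvd S $$ (i, i) * a \<longleftrightarrow> ?q dvd a"
        using p False by (simp add: prime_dvd_mult_iff)
      then show ?thesis
        using False q zdvd_not_zless[of a ?q] by (force simp: B_def cong_0_iff)
    qed
    ultimately show ?thesis
      using S x by (auto simp: kernel_mod_def)
  qed
  \<comment> \<open>Passing from vectors to extensional functions turns the kernel into a product of
    the sets \<open>B i\<close>.\<close>
  have "bij_betw (\<lambda>x. \<lambda>i\<in>{..<k}. x $ i) (kernel_mod ?q S) (Pi\<^sub>E {..<k} B)"
  proof (rule bij_betw_byWitness[of _ "vec k"])
    show "\<forall>x\<in>kernel_mod ?q S. vec k (\<lambda>i\<in>{..<k}. x $ i) = x"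
      using S by (auto simp: kernel_mod_def intro!: eq_vecI)
    show "\<forall>f\<in>Pi\<^sub>E {..<k} B. (\<lambda>i\<in>{..<k}. vec k f $ i) = f"
    proof (intro ballI ext)
      fix f i assume f: "f \<in> Pi\<^sub>E {..<k} B"
      show "(\<lambda>i\<in>{..<k}. vec k f $ i) i = f i"
        using PiE_arb[OF f, of i] by (cases "i < k") auto
    qed
    show "(\<lambda>x. \<lambda>i\<in>{..<k}. x $ i) ` kernel_mod ?q S \<subseteq> Pi\<^sub>E {..<k} B"
    proof (intro image_subsetI)
      fix x assume x: "x \<in> kernel_mod ?q S"
      then have "x \<in> carrier_vec k" using S by (auto simp: kernel_mod_def)
      from mem[OF this] x show "(\<lambda>i\<in>{..<k}. x $ i) \<in> Pi\<^sub>E {..<k} B" by simp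
    qed
    show "vec k ` Pi\<^sub>E {..<k} B \<subseteq> kernel_mod ?q S"
    proof (intro image_subsetI)
      fix f assume "f \<in> Pi\<^sub>E {..<k} B"
      then have "\<forall>i<k. vec k f $ i \<in> B i" by auto
      with mem[of "vec k f"] show "vec k f \<in> kernel_mod ?q S" by simp
    qed
  qed
  then have "card (kernel_mod ?q S) = (\<Prod>i<k. card (B i))"
    by (simp add: bij_betw_same_card card_PiE)
  also have "\<dots> = (\<Prod>i<k. if [S $$ (i, i) = 0] (mod ?q) then p else 1)"
    by (intro prod.cong) (auto simp: B_def)
  also have "\<dots> = p ^ card {i \<in> {..<k}. [S $$ (i, i) = 0] (mod ?q)}"
    by (subst prod.inter_filter[symmetric]) auto
  finally show ?thesis by simp
qed


section \<open>Orbits of the affine group modulo a prime\<close>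

text \<open>The action of \<open>Aut_mod\<close> in explicit integer representatives; the
  restriction to \<open>A\<close> keeps the result extensional, as colorings are.\<close>

definition affine_image :: "'a set \<Rightarrow> int \<Rightarrow> int \<Rightarrow> int \<Rightarrow> ('a \<Rightarrow> int) \<Rightarrow> 'a \<Rightarrow> int" where
  "affine_image A q l m C = (\<lambda>a\<in>A. (l * C a + m) mod q)"

definition affine_orbit :: "'a set \<Rightarrow> int \<Rightarrow> ('a \<Rightarrow> int) \<Rightarrow> ('a \<Rightarrow> int) set" where
  "affine_orbit A q C = {affine_image A q l m C | l m. l \<in> {1..<q} \<and> m \<in> {0..<q}}"

text \<open>This is the composition law of affine maps, with slope and shift reduced modulo
  \<open>q\<close>.\<close>

lemma affine_image_affine_image:
  "affine_image A q l m (affine_image A q l' m' C)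
     = affine_image A q ((l * l') mod q) ((l * m' + m) mod q) C"
proof -
  have "(l * ((l' * x + m') mod q) + m) mod q
      = ((l * l') mod q * x + (l * m' + m) mod q) mod q" for x :: int
  proof -
    have "[l * ((l' * x + m') mod q) + m = l * (l' * x + m') + m] (mod q)"
      by (intro cong_add cong_mult) auto
    also have "l * (l' * x + m') + m = (l * l') * x + (l * m' + m)"
      by (simp add: algebra_simps)
    also have "[\<dots> = (l * l') mod q * x + (l * m' + m) mod q] (mod q)"
      by (intro cong_add cong_mult) (auto simp: cong_def)
    finally show ?thesis by (simp add: cong_def)
  qed
  then show ?thesis by (auto simp: affine_image_def fun_eq_iff)
qed

lemma mod_prime_unit_mult:
  assumes "prime (q :: int)" "l \<in> {1..<q}" "l' \<in> {1..<q}"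
  shows "(l * l') mod q \<in> {1..<q}"
proof -
  have "\<not> q dvd l" "\<not> q dvd l'"
    using assms by (auto simp: zdvd_not_zless)
  then have "(l * l') mod q \<noteq> 0"
    using assms(1) by (metis dvd_eq_mod_eq_0 prime_dvd_mult_iff)
  moreover have "0 \<le> (l * l') mod q" "(l * l') mod q < q"
    using assms(1) by (auto simp: prime_gt_0_int)
  ultimately show ?thesis by simp
qed

lemma affine_orbit_trans:
  assumes "prime q" "C' \<in> affine_orbit A q C"
  shows "affine_orbit A q C' \<subseteq> affine_orbit A q C"
proof
  fix X assume "X \<in> affine_orbit A q C'"
  then obtain l m where X: "X = affine_image A q l m C'" "l \<in> {1..<q}" "m \<in> {0..<q}"
    by (auto simp: affine_orbit_def)
  obtain l' m' where C': "C' = affine_image A q l' m' C" "l' \<in> {1..<q}" "m' \<in> {0..<q}"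
    using assms(2) by (auto simp: affine_orbit_def)
  have "(l * m' + m) mod q \<in> {0..<q}"
    using assms(1) by (simp add: prime_gt_0_int)
  then show "X \<in> affine_orbit A q C"
    using mod_prime_unit_mult[OF assms(1) X(2) C'(2)]
    unfolding affine_orbit_def X(1) C'(1) affine_image_affine_image by blast
qed

lemma affine_image_id:
  assumes "C \<in> A \<rightarrow>\<^sub>E {0..<q}"
  shows "affine_image A q 1 0 C = C"
  using assms by (auto simp: affine_image_def fun_eq_iff PiE_iff extensional_def)

lemma affine_orbit_refl:
  assumes "prime q" "C \<in> A \<rightarrow>\<^sub>E {0..<q}"
  shows "C \<in> affine_orbit A q C"
proof -
  have "1 \<in> {1..<q}" "0 \<in> {0..<q}"
    using prime_gt_1_int[OF assms(1)] by auto
  then show ?thesis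
    unfolding affine_orbit_def using affine_image_id[OF assms(2)] by force
qed

text \<open>The inverse of \<open>x\<close> to \<open>l * x + m\<close> has slope \<open>l'\<close>,
  the inverse of \<open>l\<close> modulo \<open>q\<close>, and shift \<open>- (l' * m)\<close>. As
  \<open>C\<close> has reduced values, the composite gives back \<open>C\<close> itself.\<close>

lemma affine_orbit_sym:
  assumes q: "prime q" and C: "C \<in> A \<rightarrow>\<^sub>E {0..<q}" and C': "C' \<in> affine_orbit A q C"
  shows "C \<in> affine_orbit A q C'"
proof -
  obtain l m where lm: "C' = affine_image A q l m C" "l \<in> {1..<q}" "m \<in> {0..<q}"
    using C' by (auto simp: affine_orbit_def)
  have q1: "q > 1" using q by (rule prime_gt_1_int)
  have "coprime l q"
    using q lm(2) by (metis atLeastLessThan_iff coprime_commute prime_imp_coprime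
        zdvd_not_zless zero_less_one_class.zero_less_one order_less_le_trans)
  then obtain k where k: "[l * k = 1] (mod q)"
    using cong_solve_coprime_int by blast
  define l' where "l' = k mod q"
  have l'l: "(l' * l) mod q = 1"
    using k q1 by (simp add: l'_def cong_def mult.commute mod_mult_right_eq)
  have "l' \<noteq> 0" using l'l by auto
  then have l': "l' \<in> {1..<q}"
    using pos_mod_bound[of q k] pos_mod_sign[of q k] q1 unfolding l'_def atLeastLessThan_iff
    by linarith
  have "(l' * m + (- (l' * m)) mod q) mod q = 0"
    by (simp add: mod_add_right_eq)
  then have "affine_image A q l' ((- (l' * m)) mod q) C' = C"
    unfolding lm(1) affine_image_affine_image l'l using affine_image_id[OF C] by simp
  moreover have "(- (l' * m)) mod q \<in> {0..<q}" using q1 by simp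
  ultimately show ?thesis
    using l' unfolding affine_orbit_def by force
qed

text \<open>An affine map over a field is determined by its values at two distinct points, here
  \<open>C a\<close> and \<open>C b\<close>, so different pairs \<open>(l, m)\<close> give different
  images.\<close>

lemma card_affine_orbit:
  assumes q: "prime q"
    and ab: "a \<in> A" "b \<in> A" "C a \<in> {0..<q}" "C b \<in> {0..<q}" "C a \<noteq> C b"
  shows "card (affine_orbit A q C) = nat (q - 1) * nat q"
proof -
  have eqI: "x = y" if "[x = y] (mod q)" "x \<in> {0..<q}" "y \<in> {0..<q}" for x y
    using that by (simp add: cong_def)
  have "inj_on (\<lambda>(l, m). affine_image A q l m C) ({1..<q} \<times> {0..<q})"
  proof (clarsimp simp: inj_on_def)
    fix l m l' m'
    assume lm: "1 \<le> l" "l < q" "0 \<le> m" "m < q" "1 \<le> l'" "l' < q" "0 \<le> m'" "m' < q"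
      and eq: "affine_image A q l m C = affine_image A q l' m' C"
    have cong: "[l * C x + m = l' * C x + m'] (mod q)" if "x \<in> A" for x
      using fun_cong[OF eq, of x] that by (simp add: affine_image_def cong_def)
    \<comment> \<open>Subtracting the congruences at \<open>a\<close> and \<open>b\<close>
      eliminates the shifts and isolates \<open>(l - l') * (C a - C b)\<close>.\<close>
    have "[(l * C a + m) - (l * C b + m) = (l' * C a + m') - (l' * C b + m')] (mod q)"
      using ab by (intro cong_diff cong)
    then have "q dvd (l - l') * (C a - C b)"
      by (simp add: cong_iff_dvd_diff algebra_simps)
    moreover have "\<not> q dvd C a - C b"
      using ab eqI[of "C a" "C b"] by (auto simp: cong_iff_dvd_diff)
    ultimately have "q dvd l - l'"
      using q by (simp add: prime_dvd_mult_iff)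
    then have l: "l = l'"
      using lm by (intro eqI) (auto simp: cong_iff_dvd_diff)
    have "[m = m'] (mod q)"
      using cong[OF ab(1)] l by (simp add: cong_add_lcancel)
    then have "m = m'" using lm by (intro eqI) auto
    with l show "l = l' \<and> m = m'" by simp
  qed
  then have "card ((\<lambda>(l, m). affine_image A q l m C) ` ({1..<q} \<times> {0..<q}))
      = nat (q - 1) * nat q"
    by (simp add: card_image card_cartesian_product)
  moreover have "affine_orbit A q C = (\<lambda>(l, m). affine_image A q l m C) ` ({1..<q} \<times> {0..<q})"
    by (auto simp: affine_orbit_def; blast)
  ultimately show ?thesis by simp
qed

text \<open>The orbits partition \<open>X\<close> into blocks of equal size, since no member of
  \<open>X\<close> is constant.\<close>

lemma card_affine_orbits:
  assumes q: "prime q" and fin: "finite X" and X: "X \<subseteq> A \<rightarrow>\<^sub>E {0..<q}"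
    and nonconst: "\<And>C. C \<in> X \<Longrightarrow> \<exists>a\<in>A. \<exists>b\<in>A. C a \<noteq> C b"
    and closed: "\<And>C. C \<in> X \<Longrightarrow> affine_orbit A q C \<subseteq> X"
  shows "nat (q - 1) * nat q * card (affine_orbit A q ` X) = card X"
proof -
  have "\<Union> (affine_orbit A q ` X) = X"
  proof
    show "\<Union> (affine_orbit A q ` X) \<subseteq> X" using closed by (rule UN_least)
    show "X \<subseteq> \<Union> (affine_orbit A q ` X)"
      using affine_orbit_refl[OF q subsetD[OF X]] by (intro subsetI UN_I)
  qed
  moreover have "nat (q - 1) * nat q * card (affine_orbit A q ` X) = card (\<Union> (affine_orbit A q ` X))"
  proof (rule card_partition)
    show "finite (affine_orbit A q ` X)" using fin by simp
    show "finite (\<Union> (affine_orbit A q ` X))" using fin calculation by simp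
    fix c assume "c \<in> affine_orbit A q ` X"
    then obtain C where C: "C \<in> X" "c = affine_orbit A q C" by auto
    obtain a b where "a \<in> A" "b \<in> A" "C a \<noteq> C b" using nonconst C by blast
    moreover have "C \<in> A \<rightarrow>\<^sub>E {0..<q}" using C X by blast
    ultimately show "card c = nat (q - 1) * nat q"
      unfolding C(2) using q by (intro card_affine_orbit) (auto simp: PiE_iff)
  next
    fix c c' assume cc: "c \<in> affine_orbit A q ` X" "c' \<in> affine_orbit A q ` X" "c \<noteq> c'"
    then obtain C C' where C: "C \<in> X" "c = affine_orbit A q C" "C' \<in> X" "c' = affine_orbit A q C'"
      by auto
    \<comment> \<open>Transitivity gives one inclusion directly and the other after exchanging
      \<open>C\<close> and \<open>E\<close> by symmetry.\<close>
    have orbit_eq: "affine_orbit A q E = affine_orbit A q C"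
      if "C \<in> X" "E \<in> affine_orbit A q C" for C E
      using affine_orbit_trans[OF q that(2)]
        affine_orbit_trans[OF q affine_orbit_sym[OF q subsetD[OF X that(1)] that(2)]]
      by (rule equalityI)
    show "c \<inter> c' = {}"
    proof (rule ccontr)
      assume "c \<inter> c' \<noteq> {}"
      then obtain E where "E \<in> c" "E \<in> c'" by blast
      then have "c = c'" using orbit_eq[OF C(1)] orbit_eq[OF C(3)] C(2,4) by metis
      with cc(3) show False by simp
    qed
  qed
  ultimately show ?thesis by simp
qed


section \<open>Counting colorings\<close>

lemma carrier_residue_ring: "carrier (residue_ring q) = {0..<q}"
  by (auto simp: residue_ring_def)

lemma coloring_condition_iff:
  "x \<oplus>\<^bsub>residue_ring q\<^esub> x = y \<oplus>\<^bsub>residue_ring q\<^esub> z \<longleftrightarrow> [y + z - 2 * x = 0] (mod q)"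
proof -
  have "x \<oplus>\<^bsub>residue_ring q\<^esub> x = y \<oplus>\<^bsub>residue_ring q\<^esub> z \<longleftrightarrow> [x + x = y + z] (mod q)"
    by (simp add: residue_ring_def cong_def)
  also have "\<dots> \<longleftrightarrow> [y + z - 2 * x = 0] (mod q)"
    by (metis cong_diff_iff_cong_0 cong_sym_eq mult_2)
  finally show ?thesis .
qed

lemma colorings_iff:
  "C \<in> colorings D m \<longleftrightarrow> C \<in> arcs D \<rightarrow>\<^sub>E {0..<int m} \<and>
     (\<forall>c\<in>crossings D.
        [C (under_arc_in D c) + C (under_arc_out D c) - 2 * C (over_arc D c) = 0] (mod int m))"
  unfolding colorings_def carrier_residue_ring coloring_condition_iff by blast

text \<open>Each indicator picks out one summand, and coinciding arcs simply add their coefficients.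
  The three arcs must belong to \<open>arcs D\<close>, as an indicator of anything else would sum to
  0.\<close>

lemma sum_coloring_coeff:
  assumes D: "is_diagram D" and c: "c \<in> crossings D" and fin: "finite (arcs D)"
  shows "(\<Sum>a\<in>arcs D. coloring_coeff D c a * C a)
      = C (under_arc_in D c) + C (under_arc_out D c) - 2 * C (over_arc D c)"
proof -
  have pick: "(\<Sum>a\<in>arcs D. of_bool (a = b) * C a) = C b" if "b \<in> arcs D" for b
  proof -
    have "(\<Sum>a\<in>arcs D. of_bool (a = b) * C a) = (\<Sum>a\<in>arcs D. if a = b then C a else 0)"
      by (intro sum.cong) auto
    then show ?thesis using that fin by simp
  qed
  have "(\<Sum>a\<in>arcs D. coloring_coeff D c a * C a)
      = (\<Sum>a\<in>arcs D. of_bool (a = under_arc_in D c) * C a)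
        + (\<Sum>a\<in>arcs D. of_bool (a = under_arc_out D c) * C a)
        - 2 * (\<Sum>a\<in>arcs D. of_bool (a = over_arc D c) * C a)"
    by (simp only: coloring_coeff_def left_diff_distrib distrib_right mult.assoc
        sum.distrib sum_subtractf sum_distrib_left)
  then show ?thesis
    by (simp only: pick over_arc_in_arcs[OF D c] under_arcs_in_arcs[OF D c])
qed

text \<open>Listing the arcs turns a coloring into a vector of its colors; the rows of
  \<open>A\<close> express the crossing conditions, and padding rows say
  \<open>0 = 0\<close>.\<close>

lemma card_colorings_eq_card_kernel_mod:
  assumes D: "is_diagram D" and A: "is_coloring_matrix D A" and m: "m > 0"
  shows "card (colorings D m) = card (kernel_mod (int m) A)"
proof -
  obtain as cs where as: "distinct as" "set as = arcs D" and cs: "set cs = crossings D"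
    and A_eq: "A = mat (max (length as) (length cs)) (length as)
      (\<lambda>(i, j). if i < length cs then coloring_coeff D (cs ! i) (as ! j) else 0)"
  proof -
    show thesis
      using A unfolding is_coloring_matrix_def by (elim exE conjE) (rule that; assumption)
  qed
  let ?k = "length as" and ?r = "max (length as) (length cs)"
  define vec_of where "vec_of = (\<lambda>C :: (real ^ 3) set \<Rightarrow> int. vec ?k (\<lambda>j. C (as ! j)))"
  have bij: "bij_betw ((!) as) {..<?k} (arcs D)"
    using bij_betw_nth[OF as(1) refl as(2)[symmetric]] .
  have dims: "dim_row A = ?r" "dim_col A = ?k" by (auto simp: A_eq)
  have entry: "(A *\<^sub>v vec_of C) $ i = (if i < length cs then
      C (under_arc_in D (cs ! i)) + C (under_arc_out D (cs ! i)) - 2 * C (over_arc D (cs ! i))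
      else 0)" if "i < ?r" for C i
  proof (cases "i < length cs")
    case True
    have "(A *\<^sub>v vec_of C) $ i = (\<Sum>j<?k. coloring_coeff D (cs ! i) (as ! j) * C (as ! j))"
      using True that by (simp add: A_eq vec_of_def scalar_prod_def atLeast0LessThan)
    also have "\<dots> = (\<Sum>a\<in>arcs D. coloring_coeff D (cs ! i) a * C a)"
      by (rule sum.reindex_bij_betw[OF bij])
    also have "\<dots> = C (under_arc_in D (cs ! i)) + C (under_arc_out D (cs ! i))
        - 2 * C (over_arc D (cs ! i))"
      using True cs as by (intro sum_coloring_coeff[OF D]) (auto simp flip: cs as(2))
    finally show ?thesis using True by simp
  next
    case False
    then show ?thesis using that by (simp add: A_eq vec_of_def scalar_prod_def)
  qed
  have "vec_mod (int m) (A *\<^sub>v vec_of C) = 0\<^sub>v ?r \<longleftrightarrow> (\<forall>i<length cs.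
      [C (under_arc_in D (cs ! i)) + C (under_arc_out D (cs ! i)) - 2 * C (over_arc D (cs ! i)) = 0]
        (mod int m))" for C
  proof -
    have "vec_mod (int m) (A *\<^sub>v vec_of C) = 0\<^sub>v ?r
        \<longleftrightarrow> (\<forall>i<?r. (A *\<^sub>v vec_of C) $ i mod int m = 0)"
      using dims by (auto simp: vec_eq_iff)
    also have "\<dots> \<longleftrightarrow> (\<forall>i<?r. i < length cs \<longrightarrow>
        [C (under_arc_in D (cs ! i)) + C (under_arc_out D (cs ! i))
          - 2 * C (over_arc D (cs ! i)) = 0] (mod int m))"
      by (intro all_cong) (simp add: entry cong_def del: index_mult_mat_vec)
    finally show ?thesis by auto
  qed
  then have kernel: "vec_mod (int m) (A *\<^sub>v vec_of C) = 0\<^sub>v ?r \<longleftrightarrow> (\<forall>c\<in>crossings D.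
      [C (under_arc_in D c) + C (under_arc_out D c) - 2 * C (over_arc D c) = 0] (mod int m))" for C
    by (simp add: all_set_conv_all_nth flip: cs)
  have range: "vec_mod (int m) (vec_of C) = vec_of C \<longleftrightarrow> (\<forall>a\<in>arcs D. C a \<in> {0..<int m})" for C
  proof -
    have "a mod int m = a \<longleftrightarrow> a \<in> {0..<int m}" for a
      using m by (metis atLeastLessThan_iff mod_pos_pos_trivial of_nat_0_less_iff
          pos_mod_bound pos_mod_sign)
    then have "vec_mod (int m) (vec_of C) = vec_of C \<longleftrightarrow> (\<forall>j<?k. C (as ! j) \<in> {0..<int m})"
      by (auto simp: vec_of_def vec_eq_iff)
    then show ?thesis by (simp add: all_set_conv_all_nth flip: as(2))
  qed
  \<comment> \<open>\<open>vec_of\<close> sees only the values on arcs, so extensionality has to be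
    supplied separately.\<close>
  have mem: "vec_of C \<in> kernel_mod (int m) A \<longleftrightarrow> C \<in> colorings D m"
    if "C \<in> extensional (arcs D)" for C
  proof -
    have "vec_of C \<in> carrier_vec ?k" by (simp add: vec_of_def)
    then show ?thesis
      using that by (simp add: kernel_mod_def dims kernel range colorings_iff PiE_iff)
  qed
  have "bij_betw vec_of (colorings D m) (kernel_mod (int m) A)"
  proof (rule bij_betw_imageI)
    show "inj_on vec_of (colorings D m)"
    proof (rule inj_onI)
      fix C C' assume C: "C \<in> colorings D m" "C' \<in> colorings D m" and eq: "vec_of C = vec_of C'"
      have "C (as ! j) = C' (as ! j)" if "j < ?k" for j
        using arg_cong[OF eq, of "\<lambda>v. v $ j"] that by (simp add: vec_of_def)
      then have "\<forall>a\<in>arcs D. C a = C' a"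
        by (simp add: all_set_conv_all_nth flip: as(2))
      then show "C = C'"
        using C by (intro PiE_ext[of C "arcs D" "\<lambda>_. {0..<int m}" C']) (auto simp: colorings_iff)
    qed
    show "vec_of ` colorings D m = kernel_mod (int m) A"
    proof (intro equalityI subsetI)
      fix x assume "x \<in> vec_of ` colorings D m"
      then show "x \<in> kernel_mod (int m) A"
        using mem by (auto simp: colorings_iff PiE_iff)
    next
      fix x assume x: "x \<in> kernel_mod (int m) A"
      \<comment> \<open>The preimage of \<open>x\<close> gives each arc the entry at its position in
        \<open>as\<close>, which is unique because the list is distinct.\<close>
      define C where "C = (\<lambda>a\<in>arcs D. x $ inv_into {..<?k} ((!) as) a)"
      have "vec_of C = x"
      proof (rule eq_vecI)
        show "dim_vec (vec_of C) = dim_vec x"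
          using x dims by (auto simp: vec_of_def kernel_mod_def)
        fix j assume "j < dim_vec x"
        then have j: "j < ?k" using x dims by (auto simp: kernel_mod_def)
        then have "inv_into {..<?k} ((!) as) (as ! j) = j"
          using bij by (intro inv_into_f_f) (auto simp: bij_betw_def)
        then show "vec_of C $ j = x $ j"
          using j by (simp add: vec_of_def C_def flip: as(2))
      qed
      moreover have "C \<in> extensional (arcs D)" by (simp add: C_def)
      ultimately show "x \<in> vec_of ` colorings D m"
        using mem x by blast
    qed
  qed
  then show ?thesis by (rule bij_betw_same_card)
qed

lemma card_colorings:
  assumes D: "is_diagram D" and n: "has_nullity D p n" and p: "prime p"
  shows "card (colorings D p) = p ^ n"
proof -
  obtain A S where A: "is_coloring_matrix D A" and S: "is_smith_normal_form A S"
    and n_eq: "n = card {i. i < min (dim_row S) (dim_col S) \<and> [S $$ (i, i) = 0] (mod int p)}"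
  proof -
    show thesis
      using n unfolding has_nullity_def by (elim exE conjE) (rule that; assumption)
  qed
  obtain P Q where P: "P \<in> carrier_mat (dim_row A) (dim_row A)" "invertible_mat P"
    and Q: "Q \<in> carrier_mat (dim_col A) (dim_col A)" "invertible_mat Q"
    and S_eq: "S = P * A * Q"
  proof -
    show thesis
      using S unfolding is_smith_normal_form_def by (elim exE conjE) (rule that; assumption)
  qed
  have dims: "dim_row S = dim_row A" "dim_col S = dim_col A"
    using P Q S_eq by auto
  \<comment> \<open>With at least as many rows as columns, the diagonal has exactly one entry per
    column, so the nullity counts free coordinates.\<close>
  have le: "dim_col A \<le> dim_row A"
    using A by (auto simp: is_coloring_matrix_def)
  have "card (colorings D p) = card (kernel_mod (int p) A)"
    using card_colorings_eq_card_kernel_mod[OF D A] p prime_gt_0_nat by blast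
  also have "\<dots> = card (kernel_mod (int p) S)"
    unfolding S_eq using P Q by (intro card_kernel_mod_equivalent[symmetric]) auto
  also have "\<dots> = p ^ card {i. i < dim_col A \<and> [S $$ (i, i) = 0] (mod int p)}"
    using S le p dims
    by (intro card_kernel_mod_diagonal[of S "dim_row A"]) (auto simp: is_smith_normal_form_def)
  also have "card {i. i < dim_col A \<and> [S $$ (i, i) = 0] (mod int p)} = n"
    using le by (simp add: n_eq dims min_absorb2)
  finally show ?thesis .
qed

text \<open>Constants satisfy every crossing condition because \<open>x + x - 2 * x = 0\<close>, and
  evaluation at a chosen arc \<open>a0\<close> recovers the constant.\<close>

lemma card_trivial_colorings:
  assumes D: "is_diagram D" and ne: "arcs D \<noteq> {}"
  shows "card {C \<in> colorings D m. trivial_coloring D C} = m"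
proof -
  obtain a0 where a0: "a0 \<in> arcs D" using ne by blast
  have "bij_betw (\<lambda>x. \<lambda>a\<in>arcs D. x) {0..<int m} {C \<in> colorings D m. trivial_coloring D C}"
  proof (rule bij_betw_byWitness[of _ "\<lambda>C. C a0"])
    show "\<forall>C\<in>{C \<in> colorings D m. trivial_coloring D C}. (\<lambda>a\<in>arcs D. C a0) = C"
    proof (intro ballI ext)
      fix C a assume C: "C \<in> {C \<in> colorings D m. trivial_coloring D C}"
      show "(\<lambda>a\<in>arcs D. C a0) a = C a"
      proof (cases "a \<in> arcs D")
        case True
        then have "C a0 = C a" using C a0 unfolding trivial_coloring_def by blast
        with True show ?thesis by simp
      next
        case False
        have "C \<in> arcs D \<rightarrow>\<^sub>E {0..<int m}" using C unfolding colorings_iff by blast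
        from PiE_arb[OF this False] False show ?thesis by simp
      qed
    qed
    show "(\<lambda>x. \<lambda>a\<in>arcs D. x) ` {0..<int m} \<subseteq> {C \<in> colorings D m. trivial_coloring D C}"
      using over_arc_in_arcs[OF D] under_arcs_in_arcs[OF D]
      by (auto simp: colorings_iff trivial_coloring_def)
  qed (use a0 in \<open>auto simp: colorings_iff\<close>)
  from bij_betw_same_card[OF this] show ?thesis by simp
qed

text \<open>The coefficients 1, 1 and -2 of a crossing condition sum to 0, so the shift cancels and
  the condition is only scaled by \<open>l\<close>. Invertibility of \<open>l\<close> modulo
  \<open>p\<close> keeps distinct colors distinct.\<close>

lemma affine_image_nontrivial_coloring:
  assumes D: "is_diagram D" and p: "prime p" and C: "C \<in> nontrivial_colorings D p"
    and l: "l \<in> {1..<int p}"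
  shows "affine_image (arcs D) (int p) l m C \<in> nontrivial_colorings D p"
proof -
  let ?q = "int p" and ?C' = "affine_image (arcs D) (int p) l m C"
  have q: "prime ?q" using p by simp
  have Ccol: "C \<in> colorings D p" and nt: "\<not> trivial_coloring D C"
    using C by (auto simp: nontrivial_colorings_def)
  have val: "[?C' a = l * C a + m] (mod ?q)" if "a \<in> arcs D" for a
    using that by (simp add: affine_image_def)
  have "[?C' (under_arc_in D c) + ?C' (under_arc_out D c) - 2 * ?C' (over_arc D c) = 0] (mod ?q)"
    if c: "c \<in> crossings D" for c
  proof -
    let ?x = "C (under_arc_in D c)" and ?y = "C (under_arc_out D c)" and ?z = "C (over_arc D c)"
    have "[?C' (under_arc_in D c) + ?C' (under_arc_out D c) - 2 * ?C' (over_arc D c)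
        = (l * ?x + m) + (l * ?y + m) - 2 * (l * ?z + m)] (mod ?q)"
      using over_arc_in_arcs[OF D c] under_arcs_in_arcs[OF D c]
      by (intro cong_add cong_diff cong_mult val) auto
    also have "(l * ?x + m) + (l * ?y + m) - 2 * (l * ?z + m) = l * (?x + ?y - 2 * ?z)"
      by (simp add: algebra_simps)
    also have "[\<dots> = l * 0] (mod ?q)"
      using Ccol c by (intro cong_mult) (auto simp: colorings_iff)
    finally show ?thesis by simp
  qed
  moreover have "?C' \<in> arcs D \<rightarrow>\<^sub>E {0..<?q}"
    using prime_gt_0_int[OF q] by (auto simp: affine_image_def)
  ultimately have "?C' \<in> colorings D p" by (simp add: colorings_iff)
  moreover have "\<not> trivial_coloring D ?C'"
  proof
    assume triv: "trivial_coloring D ?C'"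
    obtain a b where ab: "a \<in> arcs D" "b \<in> arcs D" "C a \<noteq> C b"
      using nt by (auto simp: trivial_coloring_def)
    have "?C' a = ?C' b" using triv ab unfolding trivial_coloring_def by blast
    then have "[l * C a + m = l * C b + m] (mod ?q)"
      using ab by (simp add: affine_image_def cong_def)
    then have "?q dvd l * (C a - C b)"
      by (simp add: cong_iff_dvd_diff algebra_simps)
    moreover have "\<not> ?q dvd l" using l by (simp add: zdvd_not_zless)
    ultimately have "[C a = C b] (mod ?q)"
      using q by (simp add: prime_dvd_mult_iff cong_iff_dvd_diff)
    moreover have "C a \<in> {0..<?q}" "C b \<in> {0..<?q}"
      using Ccol ab by (auto simp: colorings_iff PiE_iff)
    ultimately show False using ab(3) by (simp add: cong_def)
  qed
  ultimately show ?thesis by (simp add: nontrivial_colorings_def)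
qed

text \<open>An orbit depends only on the carrier and the action. For a prime the units are the
  nonzero residues, and since colors lie in \<open>{0..<int p}\<close>, the restriction of group
  elements to that range does not affect the composition.\<close>

lemma coloring_classes_eq_affine_orbits:
  assumes p: "prime p"
  shows "coloring_classes D p = affine_orbit (arcs D) (int p) ` nontrivial_colorings D p"
proof -
  have carrier: "carrier (Aut_mod p)
      = {\<lambda>x\<in>{0..<int p}. (l * x + m) mod int p | l m. l \<in> {1..<int p} \<and> m \<in> {0..<int p}}"
  proof -
    have "Units (residue_ring (int p)) = {1..<int p}"
      unfolding residues_prime.res_prime_units_eq[OF residues_prime.intro[OF p]] by auto
    then show ?thesis
      unfolding Aut_mod_def Let_def carrier_residue_ring
      by (simp add: residue_ring_def mod_add_left_eq)
  qed
  have "orbit (Aut_mod p) (\<lambda>g C. compose (arcs D) g C) C = affine_orbit (arcs D) (int p) C"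
    if "C \<in> nontrivial_colorings D p" for C
  proof -
    have "C a \<in> {0..<int p}" if "a \<in> arcs D" for a
      using \<open>C \<in> nontrivial_colorings D p\<close> that
      by (auto simp: nontrivial_colorings_def colorings_iff PiE_iff)
    then have eq: "compose (arcs D) (\<lambda>x\<in>{0..<int p}. (l * x + m) mod int p) C
        = affine_image (arcs D) (int p) l m C" for l m
      by (auto simp: compose_def affine_image_def fun_eq_iff)
    then show ?thesis
      unfolding orbit_def carrier affine_orbit_def eq[symmetric] by blast
  qed
  then show ?thesis
    unfolding coloring_classes_def orbits_def by (auto simp: image_iff)
qed

theorem proposition3p1:
  fixes p n :: nat and L :: "(real ^ 3) set" and D :: link_diagram
  assumes "prime p" and "odd p"
    and "n > 1"
    and "is_link L"
    and "diagram_of D L"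
    and "has_nullity D p n"
  shows "real (card (coloring_classes D p)) = (real p ^ (n - 1) - 1) / (real p - 1)"
proof -
  have D: "is_diagram D" using assms(5) by (simp add: diagram_of_def)
  have p1: "p > 1" using assms(1) by (rule prime_gt_1_nat)
  have card_col: "card (colorings D p) = p ^ n"
    using card_colorings[OF D assms(6,1)] .
  \<comment> \<open>An infinite set has cardinality 0, whereas \<open>p ^ n\<close> is
    positive.\<close>
  have fin: "finite (colorings D p)"
    using card_col p1 by (intro card_ge_0_finite) simp
  \<comment> \<open>Without arcs only the empty assignment would be a coloring, contradicting
    \<open>p ^ n > 1\<close>.\<close>
  have ne: "arcs D \<noteq> {}"
  proof
    assume "arcs D = {}"
    then have "colorings D p \<subseteq> {\<lambda>_. undefined}" by (auto simp: colorings_iff)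
    then have "card (colorings D p) \<le> card {\<lambda>_ :: (real ^ 3) set. undefined :: int}"
      by (intro card_mono) simp_all
    then have "p ^ n \<le> 1" by (simp add: card_col)
    then show False using one_less_power[OF p1, of n] assms(3) by simp
  qed
  let ?T = "{C \<in> colorings D p. trivial_coloring D C}"
  have "nontrivial_colorings D p = colorings D p - ?T"
    by (auto simp: nontrivial_colorings_def)
  then have "card (nontrivial_colorings D p) = card (colorings D p) - card ?T"
    using fin by (simp add: card_Diff_subset)
  then have card_nt: "card (nontrivial_colorings D p) = p ^ n - p"
    using card_trivial_colorings[OF D ne] card_col by simp
  have "nat (int p - 1) * nat (int p) * card (coloring_classes D p) = p ^ n - p"
    unfolding coloring_classes_eq_affine_orbits[OF assms(1)] card_nt[symmetric]
  proof (rule card_affine_orbits)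
    show "prime (int p)" using assms(1) by simp
    show "finite (nontrivial_colorings D p)"
      using fin by (rule rev_finite_subset) (auto simp: nontrivial_colorings_def)
    show "nontrivial_colorings D p \<subseteq> arcs D \<rightarrow>\<^sub>E {0..<int p}"
      unfolding nontrivial_colorings_def colorings_iff by blast
    show "\<exists>a\<in>arcs D. \<exists>b\<in>arcs D. C a \<noteq> C b" if "C \<in> nontrivial_colorings D p" for C
      using that unfolding nontrivial_colorings_def trivial_coloring_def by blast
    show "affine_orbit (arcs D) (int p) C \<subseteq> nontrivial_colorings D p"
      if "C \<in> nontrivial_colorings D p" for C
      using affine_image_nontrivial_coloring[OF D assms(1) that] by (auto simp: affine_orbit_def)
  qed
  moreover have "nat (int p - 1) = p - 1" by simp
  ultimately have "real ((p - 1) * p * card (coloring_classes D p)) = real (p ^ n - p)"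
    by simp
  \<comment> \<open>This turns the truncated subtraction \<open>p ^ n - p\<close> into a genuine
    difference of reals, from which a factor \<open>p\<close> is then cancelled.\<close>
  moreover have "p \<le> p ^ n" using p1 assms(3) by (simp add: self_le_power)
  moreover have "real p ^ n = real p * real p ^ (n - 1)"
    using assms(3) by (simp flip: power_Suc)
  ultimately have "real p * ((real p - 1) * real (card (coloring_classes D p)))
      = real p * (real p ^ (n - 1) - 1)"
    using p1 by (simp add: algebra_simps)
  then have "(real p - 1) * real (card (coloring_classes D p)) = real p ^ (n - 1) - 1"
    using p1 by simp
  then show ?thesis using p1 by (simp add: field_simps)
qed

end
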